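(* Let $(X,\mu)$ be a Lebesgue space of infinite ($\sigma$-finite) measure and let $T:X\to X$ be a mixing automorphism of rank one. Then $T$ commutes only with its powers: if $S$ is an automorphism of $(X,\mu)$ with $ST=TS$, then $S=T^i$ (modulo null sets) for some $i\in\mathbb{Z}$.
   Context: An automorphism is an invertible measure-preserving transformation. Rank one: $T$ is of rank one if there is a sequence $\xi_j$ of measurable partitions of $X$ of the form $\xi_j=\{E_j,TE_j,T^2E_j,\dots,T^{h_j}E_j,\tilde E_j\}$, where $\tilde E_j=X\setminus\bigsqcup_{i=0}^{h_j}T^iE_j$, such that $\xi_j$ converges to the partition into points, i.e. every set of finite measure can be approximated in measure, as $j\to\infty$, by $\xi_j$-measurable sets. Mixing (infinite measure): for any $\varepsilon>0$ and any sets $A,B$ of finite measure there is $N$ such that $\mu(T^kA\cap B)<\varepsilon$ for all $|k|>N$. *)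

theory Defs
  imports "HOL-Analysis.Analysis"
begin

definition isomorphic_mod0 :: "'a measure \<Rightarrow> 'b measure \<Rightarrow> bool" where
  "isomorphic_mod0 M N \<longleftrightarrow>
     (\<exists>f X Y. X \<in> sets M \<and> space M - X \<in> null_sets M \<and>
              Y \<in> sets N \<and> space N - Y \<in> null_sets N \<and>
              bij_betw f X Y \<and>
              f \<in> measurable (restrict_space M X) (restrict_space N Y) \<and>
              the_inv_into X f \<in> measurable (restrict_space N Y) (restrict_space M X) \<and>
              distr (restrict_space M X) (restrict_space N Y) f = restrict_space N Y)"

text \<open>Lebesgue spaces in the sense of Rokhlin, of possibly infinite sigma-finite measure: complete
  and, modulo null sets, the completion of a sigma-finite Borel measure on the line. As in Rokhlin's
  definition, atoms are permitted.\<close>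

definition lebesgue_space :: "'a measure \<Rightarrow> bool" where
  "lebesgue_space M \<longleftrightarrow>
     complete_measure M \<and>
     (\<exists>N :: real measure. sets N = sets borel \<and> sigma_finite_measure N \<and>
        isomorphic_mod0 M (completion N))"

text \<open>Automorphisms are everywhere-defined bijections of the space; an automorphism that is
  invertible only modulo null sets agrees almost everywhere with one of these.\<close>

definition automorphism :: "'a measure \<Rightarrow> ('a \<Rightarrow> 'a) \<Rightarrow> bool" where
  "automorphism M T \<longleftrightarrow>
     bij_betw T (space M) (space M) \<and>
     T \<in> measurable M M \<and>
     the_inv_into (space M) T \<in> measurable M M \<and>
     distr M M T = M"

definition autom_power :: "'a measure \<Rightarrow> ('a \<Rightarrow> 'a) \<Rightarrow> int \<Rightarrow> 'a \<Rightarrow> 'a" where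
  "autom_power M T k =
     (if 0 \<le> k then T ^^ nat k else (the_inv_into (space M) T) ^^ nat (- k))"

definition mixing :: "'a measure \<Rightarrow> ('a \<Rightarrow> 'a) \<Rightarrow> bool" where
  "mixing M T \<longleftrightarrow>
     (\<forall>\<epsilon>>0. \<forall>A\<in>fmeasurable M. \<forall>B\<in>fmeasurable M.
        \<exists>N::nat. \<forall>k::int. \<bar>k\<bar> > int N \<longrightarrow> measure M (autom_power M T k ` A \<inter> B) < \<epsilon>)"

definition tower_partition :: "'a measure \<Rightarrow> ('a \<Rightarrow> 'a) \<Rightarrow> 'a set \<Rightarrow> nat \<Rightarrow> 'a set set" where
  "tower_partition M T E h =
     insert (space M - (\<Union>i\<le>h. (T ^^ i) ` E)) ((\<lambda>i. (T ^^ i) ` E) ` {..h})"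

text \<open>A set is measurable with respect to a finite partition if it is a union of its elements.\<close>

definition converges_to_points :: "'a measure \<Rightarrow> (nat \<Rightarrow> 'a set set) \<Rightarrow> bool" where
  "converges_to_points M \<xi> \<longleftrightarrow>
     (\<forall>A\<in>fmeasurable M. \<exists>C. (\<forall>j. C j \<subseteq> \<xi> j) \<and>
        (\<lambda>j. emeasure M ((A - \<Union>(C j)) \<union> (\<Union>(C j) - A))) \<longlonglongrightarrow> 0)"

definition rank_one :: "'a measure \<Rightarrow> ('a \<Rightarrow> 'a) \<Rightarrow> bool" where
  "rank_one M T \<longleftrightarrow>
     (\<exists>(E :: nat \<Rightarrow> 'a set) (h :: nat \<Rightarrow> nat).
        (\<forall>j. E j \<in> sets M \<and> disjoint_family_on (\<lambda>i. (T ^^ i) ` E j) {..h j}) \<and>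
        converges_to_points M (\<lambda>j. tower_partition M T (E j) (h j)))"

end

theory Submission
  imports Defs
begin

text \<open>
  Write \<open>P k\<close> for the \<open>k\<close>-th power of \<open>T\<close>. The graph of \<open>S\<close>, with the measure lifted from \<open>X\<close>,
  is compared with the graphs of the \<open>P k\<close>. Inside a tower with base \<open>E\<close> and levels
  \<open>0..h\<close>, the commutation relation makes \<open>\<mu>(S T^a E \<inter> T^b E)\<close> depend on \<open>b - a\<close>
  only: it equals \<open>w(b - a)\<close> with \<open>w(k) = \<mu>(S E \<inter> P k E)\<close>. Hence, for unions of levels
  \<open>A\<close> and \<open>B\<close>, \<open>\<mu>(S A \<inter> B)\<close> is at most the sum over \<open>|k| \<le> h\<close> of
  \<open>(w(k) / \<mu>(E)) \<mu>(P k A \<inter> B)\<close>. The total weight is at most 2, because \<open>P k E\<close>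
  for \<open>0 \<le> k \<le> h\<close>, and likewise for \<open>- h \<le> k \<le> 0\<close>, are disjoint. Replacing a
  single pair \<open>(A, B)\<close> by a finite family of rectangles and letting the towers refine gives
  \<open>commuting_domination\<close>: if a finite family of rectangles carries at most \<open>\<epsilon>\<close> of the
  graph of every power of \<open>T\<close>, then it carries at most \<open>2 \<epsilon>\<close> of the graph of \<open>S\<close>. The
  constant 2 does not depend on the tower, so no limit of the weights has to be taken.

  The set where \<open>S = P k\<close> is invariant under \<open>T\<close> modulo null sets, so by ergodicity
  (\<open>rank_one_ergodic\<close>) it is null or conull. Suppose that it is null for every \<open>k\<close>.
  Fix a set \<open>A\<close> of finite positive measure and split \<open>S A\<close> into the finitely many cells
  of a fine partition taken from a separating sequence; the rectangles are the pairs of a cell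
  and its preimage under \<open>S\<close>. They carry all of the graph of \<open>S\<close> over \<open>A\<close>. They carry little of
  the graph of \<open>P k\<close>: for large \<open>|k|\<close> by mixing, whatever the partition, and for the
  remaining finitely many \<open>k\<close> because, for a fine enough partition, \<open>S x\<close> and \<open>P k x\<close> lie in
  different cells except for a small set of \<open>x\<close>. This contradicts \<open>commuting_domination\<close>.
\<close>

section \<open>Automorphisms and their powers\<close>

lemma automorphism_image_eq:
  assumes "automorphism M F" "A \<subseteq> space M"
  shows "F ` A = the_inv_into (space M) F -` A \<inter> space M"
proof -
  have b: "bij_betw F (space M) (space M)" using assms by (simp add: automorphism_def)
  hence i: "inj_on F (space M)" "F ` space M = space M" by (auto simp: bij_betw_def)
  show ?thesis
  proof (intro equalityI subsetI)
    fix y assume "y \<in> F ` A"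
    then show "y \<in> the_inv_into (space M) F -` A \<inter> space M"
      using assms(2) i by (auto simp: the_inv_into_f_f subset_iff)
  next
    fix y assume y: "y \<in> the_inv_into (space M) F -` A \<inter> space M"
    hence "F (the_inv_into (space M) F y) = y" using i by (intro f_the_inv_into_f) auto
    then show "y \<in> F ` A" using y by (metis IntD1 imageI vimageD)
  qed
qed

lemma automorphism_inj: "automorphism M F \<Longrightarrow> inj_on F (space M)"
  by (simp add: automorphism_def bij_betw_def)

lemma automorphism_in_space: "automorphism M F \<Longrightarrow> x \<in> space M \<Longrightarrow> F x \<in> space M"
  by (auto simp: automorphism_def bij_betw_def)

lemma automorphism_measurable: "automorphism M F \<Longrightarrow> F \<in> measurable M M"
  by (simp add: automorphism_def)

lemma automorphism_image_sets:
  assumes "automorphism M F" "A \<in> sets M"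
  shows "F ` A \<in> sets M"
  using automorphism_image_eq[OF assms(1) sets.sets_into_space[OF assms(2)]] assms
  by (metis automorphism_def measurable_sets)

lemma automorphism_emeasure_image:
  assumes F: "automorphism M F" and A: "A \<in> sets M"
  shows "emeasure M (F ` A) = emeasure M A"
proof -
  have "emeasure M (F ` A) = emeasure (distr M M F) (F ` A)"
    using F by (simp add: automorphism_def)
  also have "\<dots> = emeasure M (F -` (F ` A) \<inter> space M)"
    using F A by (intro emeasure_distr automorphism_image_sets automorphism_measurable)
  also have "F -` (F ` A) \<inter> space M = A"
    using automorphism_inj[OF F] sets.sets_into_space[OF A] by (auto dest: inj_onD)
  finally show ?thesis .
qed

lemma automorphism_AE:
  assumes "automorphism M F" "AE x in M. P x"
  shows "AE x in M. P (F x)"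
proof -
  have "distr M M F = M" using assms(1) by (simp add: automorphism_def)
  with assms(2) have "AE x in distr M M F. P x" by metis
  thus ?thesis by (rule AE_distrD[OF automorphism_measurable[OF assms(1)]])
qed

lemma autom_power_of_nat: "autom_power M T (int n) = T ^^ n"
  by (simp add: autom_power_def)

lemma autom_power_0 [simp]: "autom_power M T 0 = id"
  by (simp add: autom_power_def fun_eq_iff)

lemma autom_power_measurable:
  assumes "automorphism M T"
  shows "autom_power M T k \<in> measurable M M"
  using assms by (auto simp: autom_power_def automorphism_def intro!: measurable_compose_n)

lemma autom_power_in_space:
  "automorphism M T \<Longrightarrow> x \<in> space M \<Longrightarrow> autom_power M T k x \<in> space M"
  by (rule measurable_space[OF autom_power_measurable])

lemma autom_power_succ:
  assumes T: "automorphism M T" and x: "x \<in> space M"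
  shows "autom_power M T (k + 1) x = T (autom_power M T k x)"
proof (cases "k \<ge> 0")
  case True
  then show ?thesis by (simp add: autom_power_def nat_add_distrib)
next
  case False
  define n where "n = nat (- k) - 1"
  have k: "k = - int (Suc n)" using False by (simp add: n_def)
  let ?U = "the_inv_into (space M) T"
  have y: "(?U ^^ n) x \<in> space M"
    using T x by (intro measurable_space[OF measurable_compose_n]) (auto simp: automorphism_def)
  have b: "inj_on T (space M)" "T ` space M = space M"
    using T by (auto simp: automorphism_def bij_betw_def)
  have "autom_power M T (k + 1) x = (?U ^^ n) x"
  proof -
    have "k + 1 = - int n" using k by simp
    thus ?thesis by (cases "n = 0") (simp_all add: autom_power_def)
  qed
  moreover have "autom_power M T k x = ?U ((?U ^^ n) x)"
    unfolding autom_power_def k by (simp add: nat_add_distrib del: of_nat_Suc)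
  ultimately show ?thesis using f_the_inv_into_f[OF b(1)] y b(2) by simp
qed

lemma autom_power_add:
  assumes T: "automorphism M T" and x: "x \<in> space M"
  shows "autom_power M T (a + b) x = autom_power M T a (autom_power M T b x)"
proof (induction a rule: int_induct[where k = 0])
  case base
  show ?case by simp
next
  case (step1 i)
  have "autom_power M T (i + 1 + b) x = T (autom_power M T (i + b) x)"
    using autom_power_succ[OF T x, of "i + b"] by (simp add: algebra_simps)
  also have "\<dots> = autom_power M T (i + 1) (autom_power M T b x)"
    using step1 autom_power_succ[OF T autom_power_in_space[OF T x]] by simp
  finally show ?case .
next
  case (step2 i)
  have "T (autom_power M T (i - 1 + b) x) = autom_power M T (i + b) x"
    using autom_power_succ[OF T x, of "i - 1 + b"] by (simp add: algebra_simps)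
  also have "\<dots> = T (autom_power M T (i - 1) (autom_power M T b x))"
    using step2 autom_power_succ[OF T autom_power_in_space[OF T x], of "i - 1"] by simp
  finally show ?case
    using automorphism_inj[OF T] autom_power_in_space[OF T] x by (meson inj_onD)
qed

lemma autom_power_image_add:
  assumes "automorphism M T" "A \<subseteq> space M"
  shows "autom_power M T (a + b) ` A = autom_power M T a ` autom_power M T b ` A"
  unfolding image_image using assms(2)
  by (intro image_cong refl autom_power_add[OF assms(1)]) blast

lemma autom_power_inj:
  assumes T: "automorphism M T"
  shows "inj_on (autom_power M T k) (space M)"
proof (rule inj_on_inverseI)
  fix x assume "x \<in> space M"
  thus "autom_power M T (- k) (autom_power M T k x) = x"
    using autom_power_add[OF T, of x "- k" k] by simp
qed

lemma autom_power_image_eq: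
  assumes T: "automorphism M T" and A: "A \<subseteq> space M"
  shows "autom_power M T k ` A = autom_power M T (- k) -` A \<inter> space M"
proof (intro equalityI subsetI)
  fix y assume "y \<in> autom_power M T k ` A"
  then obtain x where x: "x \<in> A" "y = autom_power M T k x" by auto
  with A have "x \<in> space M" by auto
  with x show "y \<in> autom_power M T (- k) -` A \<inter> space M"
    using autom_power_add[OF T, of x "- k" k] autom_power_in_space[OF T] by auto
next
  fix y assume y: "y \<in> autom_power M T (- k) -` A \<inter> space M"
  hence "y = autom_power M T k (autom_power M T (- k) y)"
    using autom_power_add[OF T, of y k "- k"] by auto
  with y show "y \<in> autom_power M T k ` A" by blast
qed

lemma autom_power_image_sets:
  assumes T: "automorphism M T" and A: "A \<in> sets M"
  shows "autom_power M T k ` A \<in> sets M"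
  using autom_power_image_eq[OF T sets.sets_into_space[OF A]]
    measurable_sets[OF autom_power_measurable[OF T] A] by metis

lemma autom_power_emeasure_image:
  assumes T: "automorphism M T" and A: "A \<in> sets M"
  shows "emeasure M (autom_power M T k ` A) = emeasure M A"
proof (induction k rule: int_induct[where k = 0])
  case base
  show ?case by simp
next
  case (step1 i)
  have "autom_power M T (i + 1) ` A = T ` autom_power M T i ` A"
    unfolding image_image using sets.sets_into_space[OF A] autom_power_succ[OF T]
    by (intro image_cong) auto
  thus ?case
    using step1 automorphism_emeasure_image[OF T autom_power_image_sets[OF T A]] by simp
next
  case (step2 i)
  have "autom_power M T i ` A = T ` autom_power M T (i - 1) ` A"
    unfolding image_image using sets.sets_into_space[OF A] autom_power_succ[OF T, of _ "i - 1"]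
    by (intro image_cong) auto
  thus ?case
    using step2 automorphism_emeasure_image[OF T autom_power_image_sets[OF T A]] by simp
qed

lemma automorphism_measure_image:
  "automorphism M F \<Longrightarrow> A \<in> sets M \<Longrightarrow> measure M (F ` A) = measure M A"
  by (simp add: measure_def automorphism_emeasure_image)

lemma automorphism_fmeasurable_image:
  "automorphism M F \<Longrightarrow> A \<in> fmeasurable M \<Longrightarrow> F ` A \<in> fmeasurable M"
  by (simp add: fmeasurable_def automorphism_emeasure_image automorphism_image_sets)

lemma autom_power_measure_image:
  "automorphism M T \<Longrightarrow> A \<in> sets M \<Longrightarrow> measure M (autom_power M T k ` A) = measure M A"
  by (simp add: measure_def autom_power_emeasure_image)

lemma autom_power_fmeasurable_image:
  "automorphism M T \<Longrightarrow> A \<in> fmeasurable M \<Longrightarrow> autom_power M T k ` A \<in> fmeasurable M"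
  by (simp add: fmeasurable_def autom_power_emeasure_image autom_power_image_sets)

lemma commute_funpow_AE:
  assumes T: "automorphism M T" and c: "AE x in M. S (T x) = T (S x)"
  shows "AE x in M. S ((T ^^ n) x) = (T ^^ n) (S x)"
proof (induction n)
  case (Suc n)
  from automorphism_AE[OF T Suc] c show ?case
    by eventually_elim (simp only: funpow_Suc_right o_apply)
qed auto

section \<open>Approximation by levels of a tower\<close>

definition level_union :: "('a \<Rightarrow> 'a) \<Rightarrow> 'a set \<Rightarrow> nat set \<Rightarrow> 'a set" where
  "level_union T E I = (\<Union>a\<in>I. (T ^^ a) ` E)"

lemma level_fmeasurable:
  "automorphism M T \<Longrightarrow> E \<in> fmeasurable M \<Longrightarrow> (T ^^ a) ` E \<in> fmeasurable M"
  using autom_power_fmeasurable_image[of M T E "int a"] by (simp add: autom_power_of_nat)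

lemma level_emeasure:
  "automorphism M T \<Longrightarrow> E \<in> sets M \<Longrightarrow> emeasure M ((T ^^ a) ` E) = emeasure M E"
  using autom_power_emeasure_image[of M T E "int a"] by (simp add: autom_power_of_nat)

lemma level_measure:
  "automorphism M T \<Longrightarrow> E \<in> sets M \<Longrightarrow> measure M ((T ^^ a) ` E) = measure M E"
  by (simp add: measure_def level_emeasure)

lemma level_sets:
  "automorphism M T \<Longrightarrow> E \<in> sets M \<Longrightarrow> (T ^^ a) ` E \<in> sets M"
  using autom_power_image_sets[of M T E "int a"] by (simp add: autom_power_of_nat)

lemma level_union_fmeasurable:
  "automorphism M T \<Longrightarrow> E \<in> fmeasurable M \<Longrightarrow> finite I \<Longrightarrow> level_union T E I \<in> fmeasurable M"
  unfolding level_union_def by (intro fmeasurable.finite_UN level_fmeasurable)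

lemma sigma_finite_pos_subset:
  assumes "sigma_finite_measure M" "D \<in> sets M" "emeasure M D \<noteq> 0"
  obtains A where "A \<in> fmeasurable M" "A \<subseteq> D" "measure M A > 0"
proof (cases "emeasure M D = \<infinity>")
  case True
  from sigma_finite_measure.approx_PInf_emeasure_with_finite[OF assms(1,2) True, of 1]
  obtain A where A: "A \<in> sets M" "A \<subseteq> D" "emeasure M A < \<infinity>" "ennreal 1 < emeasure M A" by auto
  have "measure M A > 0" using A
    by (metis emeasure_eq_ennreal_measure ennreal_0 ennreal_less_zero_iff infinity_ennreal_def
        less_irrefl not_gr_zero order_less_trans ennreal_zero_less_one ennreal_1)
  with A show ?thesis by (intro that[of A]) (auto intro: fmeasurableI)
next
  case False
  have "measure M D > 0" using False assms(3)
    by (simp add: measure_def enn2real_positive_iff top.not_eq_extremum zero_less_iff_neq_zero)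
  with False show ?thesis using assms(2)
    by (intro that[of D]) (auto simp: fmeasurable_def top.not_eq_extremum)
qed

text \<open>The infinite measure of the space forces the base of a late tower to have finite measure:
  a base of infinite measure would leave the remainder as the only cell able to approximate each
  of two disjoint sets of positive measure. The remainder then has infinite measure, so the
  approximating unions consist of levels alone.\<close>

lemma rank_one_level_approx:
  assumes sf: "sigma_finite_measure M" and inf: "emeasure M (space M) = \<infinity>"
    and T: "automorphism M T" and r: "rank_one M T"
  obtains E h where "\<And>j. disjoint_family_on (\<lambda>i. (T ^^ i) ` E j) {..h j :: nat}"
    and "\<And>A \<delta>. A \<in> fmeasurable M \<Longrightarrow> \<delta> > 0 \<Longrightarrow>
      \<forall>\<^sub>F j in sequentially. E j \<in> fmeasurable M \<and>
        (\<exists>I\<subseteq>{..h j}. measure M (sym_diff A (level_union T (E j) I)) < \<delta>)"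
proof -
  obtain E h where E: "\<And>j. E j \<in> sets M"
    and dis: "\<And>j. disjoint_family_on (\<lambda>i. (T ^^ i) ` E j) {..h j}"
    and conv: "converges_to_points M (\<lambda>j. tower_partition M T (E j) (h j))"
    using r unfolding rank_one_def by blast
  define R where "R j = space M - (\<Union>i\<le>h j. (T ^^ i) ` E j)" for j
  have R: "R j \<in> sets M" for j
    unfolding R_def using level_sets[OF T E] by (intro sets.Diff sets.finite_UN) auto
  have part: "\<forall>\<^sub>F j in sequentially. \<exists>C \<subseteq> tower_partition M T (E j) (h j).
      \<Union>C \<in> sets M \<and> emeasure M (sym_diff A (\<Union>C)) < ennreal \<delta>"
    if A: "A \<in> fmeasurable M" and \<delta>: "\<delta> > 0" for A \<delta>
  proof -
    obtain C where C': "\<forall>j. C j \<subseteq> tower_partition M T (E j) (h j)"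
      and C0: "(\<lambda>j. emeasure M (sym_diff A (\<Union>(C j)))) \<longlonglongrightarrow> 0"
      using conv A unfolding converges_to_points_def by meson
    from C' have C: "\<And>j. C j \<subseteq> tower_partition M T (E j) (h j)" by blast
    have "\<forall>\<^sub>F j in sequentially. emeasure M (sym_diff A (\<Union>(C j))) < ennreal \<delta>"
      using order_tendstoD(2)[OF C0, of "ennreal \<delta>"] \<delta> by simp
    moreover have "\<Union>(C j) \<in> sets M" for j
    proof (intro sets.finite_Union)
      have "finite (tower_partition M T (E j) (h j))"
        by (simp add: tower_partition_def)
      thus "finite (C j)" using C finite_subset by blast
      have "tower_partition M T (E j) (h j) \<subseteq> sets M"
        using R level_sets[OF T E] by (auto simp: tower_partition_def R_def)
      thus "C j \<subseteq> sets M" using C by blast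
    qed
    ultimately show ?thesis using C by (auto elim!: eventually_mono)
  qed
  have Cfin: "emeasure M Y < \<infinity>"
    if "emeasure M (sym_diff A (\<Union>C)) < ennreal \<delta>" "A \<in> fmeasurable M" "\<Union>C \<in> sets M"
      "Y \<in> C" for A C \<delta> Y
  proof -
    have A: "A \<in> sets M" "emeasure M A < \<infinity>" using that(2) by (auto simp: fmeasurable_def)
    have "emeasure M Y \<le> emeasure M (A \<union> sym_diff A (\<Union>C))"
      using A that by (intro emeasure_mono) auto
    also have "\<dots> \<le> emeasure M A + emeasure M (sym_diff A (\<Union>C))"
      using A that by (intro emeasure_subadditive) auto
    also have "\<dots> < \<infinity>" using A that(1) by (simp add: order_less_trans[OF _ ennreal_less_top])
    finally show ?thesis .
  qed
  have Efin: "\<forall>\<^sub>F j in sequentially. E j \<in> fmeasurable M"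
  proof -
    obtain P where P: "P \<in> fmeasurable M" "P \<subseteq> space M" "measure M P > 0"
      using sigma_finite_pos_subset[OF sf sets.top] inf by auto
    have "emeasure M (space M - P) = \<infinity>"
      using P(1) inf by (subst emeasure_Diff) (auto simp: fmeasurable_def dest: sets.sets_into_space)
    then obtain Q where Q: "Q \<in> fmeasurable M" "Q \<subseteq> space M - P" "measure M Q > 0"
      using sigma_finite_pos_subset[OF sf, of "space M - P"] P(1) by (auto simp: fmeasurable_def)
    define \<delta> where "\<delta> = min (measure M P) (measure M Q) / 2"
    have \<delta>: "\<delta> > 0" "2 * \<delta> \<le> measure M P" "2 * \<delta> \<le> measure M Q"
      using P Q by (auto simp: \<delta>_def)
    show ?thesis
      using part[OF P(1) \<delta>(1)] part[OF Q(1) \<delta>(1)]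
    proof eventually_elim
      case (elim j)
      obtain C where C: "C \<subseteq> tower_partition M T (E j) (h j)" "\<Union>C \<in> sets M"
        "emeasure M (sym_diff P (\<Union>C)) < ennreal \<delta>" using elim(1) by blast
      obtain D where D: "D \<subseteq> tower_partition M T (E j) (h j)" "\<Union>D \<in> sets M"
        "emeasure M (sym_diff Q (\<Union>D)) < ennreal \<delta>" using elim(2) by blast
      show ?case
      proof (rule ccontr)
        assume "E j \<notin> fmeasurable M"
        hence Einf: "emeasure M (E j) = \<infinity>" using E[of j] by (metis fmeasurableI infinity_ennreal_def less_top)
        have only: "C' \<subseteq> {R j}" if "C' \<subseteq> tower_partition M T (E j) (h j)"
          "\<And>Y. Y \<in> C' \<Longrightarrow> emeasure M Y < \<infinity>" for C'
        proof
          fix Y assume Y: "Y \<in> C'"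
          have "emeasure M ((T ^^ i) ` E j) = \<infinity>" for i
            using level_emeasure[OF T E] Einf by metis
          hence "Y \<noteq> (T ^^ i) ` E j" for i using that(2)[OF Y] by auto
          moreover have "Y \<in> insert (R j) ((\<lambda>i. (T ^^ i) ` E j) ` {..h j})"
            using that(1) Y unfolding tower_partition_def R_def by (rule subsetD)
          ultimately show "Y \<in> {R j}" by blast
        qed
        have CR: "C \<subseteq> {R j}" using only[OF C(1)] Cfin[OF C(3) P(1) C(2)] by blast
        have DR: "D \<subseteq> {R j}" using only[OF D(1)] Cfin[OF D(3) Q(1) D(2)] by blast
        have ne: "C \<noteq> {}" "D \<noteq> {}"
        proof -
          have P': "emeasure M P = ennreal (measure M P)" "emeasure M Q = ennreal (measure M Q)"
            using P Q by (auto simp: emeasure_eq_measure2)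
          show "C \<noteq> {}" using C(3) P'(1) \<delta> by (auto simp: ennreal_less_iff)
          show "D \<noteq> {}" using D(3) P'(2) \<delta> by (auto simp: ennreal_less_iff)
        qed
        hence eq: "\<Union>C = R j" "\<Union>D = R j" using CR DR by auto
        have "emeasure M P \<le> emeasure M (sym_diff P (R j) \<union> sym_diff Q (R j))"
          using P Q R by (intro emeasure_mono) (auto simp: fmeasurable_def)
        also have "\<dots> \<le> emeasure M (sym_diff P (R j)) + emeasure M (sym_diff Q (R j))"
          using P Q R by (intro emeasure_subadditive) (auto simp: fmeasurable_def)
        also have "\<dots> < ennreal \<delta> + ennreal \<delta>"
          using C(3) D(3) eq by (intro add_strict_mono) auto
        also have "\<dots> \<le> ennreal (measure M P)" using \<delta> by (simp flip: ennreal_plus)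
        also have "\<dots> = emeasure M P" using P by (simp add: emeasure_eq_measure2)
        finally show False by simp
      qed
    qed
  qed
  show ?thesis
  proof (rule that[of E h])
    show "disjoint_family_on (\<lambda>i. (T ^^ i) ` E j) {..h j}" for j by (rule dis)
    fix A \<delta> assume A: "A \<in> fmeasurable M" and \<delta>: "(\<delta>::real) > 0"
    show "\<forall>\<^sub>F j in sequentially. E j \<in> fmeasurable M \<and>
        (\<exists>I\<subseteq>{..h j}. measure M (sym_diff A (level_union T (E j) I)) < \<delta>)"
      using Efin part[OF A \<delta>]
    proof eventually_elim
      case (elim j)
      obtain C where C: "C \<subseteq> tower_partition M T (E j) (h j)" "\<Union>C \<in> sets M"
        "emeasure M (sym_diff A (\<Union>C)) < ennreal \<delta>" using elim(2) by blast
      have "(\<Union>i\<le>h j. (T ^^ i) ` E j) \<in> fmeasurable M"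
        using elim(1) by (intro fmeasurable.finite_UN level_fmeasurable T) auto
      hence "emeasure M (R j) = \<infinity>"
        unfolding R_def using inf
        by (subst emeasure_Diff) (auto simp: fmeasurable_def dest: sets.sets_into_space)
      hence "R j \<notin> C" using Cfin[OF C(3) A C(2)] by fastforce
      hence sub: "C \<subseteq> (\<lambda>i. (T ^^ i) ` E j) ` {..h j}"
        using C(1) by (auto simp: tower_partition_def R_def)
      define I where "I = {a \<in> {..h j}. (T ^^ a) ` E j \<in> C}"
      have "C = (\<lambda>a. (T ^^ a) ` E j) ` I" using sub unfolding I_def by blast
      hence "\<Union>C = level_union T (E j) I" by (simp add: level_union_def)
      hence "emeasure M (sym_diff A (level_union T (E j) I)) < ennreal \<delta>" using C(3) by simp
      hence "measure M (sym_diff A (level_union T (E j) I)) < \<delta>"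
        using \<delta> by (metis emeasure_eq_ennreal_measure ennreal_less_iff measure_nonneg
            ennreal_less_top order_less_trans top.not_eq_extremum)
      moreover have "I \<subseteq> {..h j}" by (auto simp: I_def)
      ultimately show ?case using elim(1) by blast
    qed
  qed
qed

section \<open>Ergodicity\<close>

text \<open>An invariant set meets all levels of a tower in the same measure. Were both the set and its
  complement of positive measure, then a fine tower would have levels lying mostly in the set
  and levels lying mostly in the complement.\<close>

lemma rank_one_ergodic:
  assumes sf: "sigma_finite_measure M" and inf: "emeasure M (space M) = \<infinity>"
    and T: "automorphism M T" and r: "rank_one M T"
    and D: "D \<in> sets M" and inv: "AE x in M. x \<in> D \<longleftrightarrow> T x \<in> D"
  shows "(AE x in M. x \<in> D) \<or> (AE x in M. x \<notin> D)"
proof (rule ccontr)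
  assume "\<not> ?thesis"
  hence n: "\<not> (AE x in M. x \<in> D)" "\<not> (AE x in M. x \<notin> D)" by auto
  have "emeasure M D \<noteq> 0"
    using n(2) D AE_not_in[of D M] by (auto simp: null_sets_def)
  then obtain A where A: "A \<in> fmeasurable M" "A \<subseteq> D" "measure M A > 0"
    using sigma_finite_pos_subset[OF sf D] by blast
  have "emeasure M (space M - D) \<noteq> 0"
  proof
    assume "emeasure M (space M - D) = 0"
    hence "AE x in M. x \<notin> space M - D" using D by (intro AE_not_in) (auto simp: null_sets_def)
    hence "AE x in M. x \<in> D" using AE_space by eventually_elim auto
    with n show False by simp
  qed
  then obtain B where B: "B \<in> fmeasurable M" "B \<subseteq> space M - D" "measure M B > 0"
    using sigma_finite_pos_subset[OF sf, of "space M - D"] D by blast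
  define \<delta> where "\<delta> = min (measure M A) (measure M B) / 4"
  have \<delta>: "\<delta> > 0" "4 * \<delta> \<le> measure M A" "4 * \<delta> \<le> measure M B"
    using A B by (auto simp: \<delta>_def)
  obtain E h where dis: "\<And>j. disjoint_family_on (\<lambda>i. (T ^^ i) ` E j) {..h j :: nat}"
    and app: "\<And>A \<delta>. A \<in> fmeasurable M \<Longrightarrow> \<delta> > 0 \<Longrightarrow>
      \<forall>\<^sub>F j in sequentially. E j \<in> fmeasurable M \<and>
        (\<exists>I\<subseteq>{..h j}. measure M (sym_diff A (level_union T (E j) I)) < \<delta>)"
    using rank_one_level_approx[OF sf inf T r] by blast
  obtain j where "E j \<in> fmeasurable M \<and>
        (\<exists>I\<subseteq>{..h j}. measure M (sym_diff A (level_union T (E j) I)) < \<delta>)"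
      "(\<exists>I\<subseteq>{..h j}. measure M (sym_diff B (level_union T (E j) I)) < \<delta>)"
    using eventually_happens[OF eventually_conj[OF app[OF A(1) \<delta>(1)] app[OF B(1) \<delta>(1)]]]
    by auto
  then obtain I J where E: "E j \<in> fmeasurable M"
    and I: "I \<subseteq> {..h j}" "measure M (sym_diff A (level_union T (E j) I)) < \<delta>"
    and J: "J \<subseteq> {..h j}" "measure M (sym_diff B (level_union T (E j) J)) < \<delta>"
    by blast
  have Es: "E j \<in> sets M" using E by auto
  define e p where "e = measure M (E j)" and "p = measure M (E j \<inter> D)"
  \<comment> \<open>Moving a level up by \<open>T\<close> maps its part in \<open>D\<close> onto the part of the next level in \<open>D\<close>.\<close>
  have lev: "measure M ((T ^^ a) ` E j \<inter> D) = p" for a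
  proof (induction a)
    case (Suc a)
    let ?L = "(T ^^ a) ` E j"
    have L: "?L \<in> sets M" by (rule level_sets[OF T Es])
    have pre: "T -` D \<inter> space M \<in> sets M" by (rule measurable_sets[OF automorphism_measurable[OF T] D])
    have "(T ^^ Suc a) ` E j \<inter> D = T ` (?L \<inter> (T -` D \<inter> space M))"
      using sets.sets_into_space[OF L] by (auto simp: image_image)
    hence "measure M ((T ^^ Suc a) ` E j \<inter> D) = measure M (?L \<inter> (T -` D \<inter> space M))"
      using automorphism_measure_image[OF T] L pre by auto
    also have "\<dots> = measure M (?L \<inter> D)"
      using inv AE_space L pre D by (intro measure_eq_AE) (auto elim!: eventually_elim2)
    finally show ?case using Suc by simp
  qed (simp add: p_def)
  have lU: "measure M (level_union T (E j) K) = card K * e"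
    "measure M (level_union T (E j) K \<inter> D) = card K * p"
    "measure M (level_union T (E j) K - D) = card K * (e - p)" if K: "K \<subseteq> {..h j}" for K
  proof -
    have fin: "finite K" using K finite_subset by blast
    have dK: "disjoint_family_on (\<lambda>i. (T ^^ i) ` E j) K"
      using dis[of j] K by (rule disjoint_family_on_mono[rotated])
    show 1: "measure M (level_union T (E j) K) = card K * e"
      unfolding level_union_def using fin dK level_fmeasurable[OF T E]
      by (subst measure_finite_Union) (auto simp: level_measure[OF T Es] e_def dest: fmeasurableD2)
    have "measure M (\<Union>i\<in>K. (T ^^ i) ` E j \<inter> D) = card K * p"
      using fin dK level_fmeasurable[OF T E] D
      by (subst measure_finite_Union)
        (auto simp: lev disjoint_family_on_def fmeasurableD2 intro!: fmeasurableD2 fmeasurable_Int_fmeasurable)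
    thus 2: "measure M (level_union T (E j) K \<inter> D) = card K * p"
      by (simp add: level_union_def)
    have f: "level_union T (E j) K \<in> fmeasurable M" by (rule level_union_fmeasurable[OF T E fin])
    have "measure M (level_union T (E j) K) =
      measure M (level_union T (E j) K \<inter> D) + measure M (level_union T (E j) K - D)"
      using f D by (subst measure_Union[symmetric])
        (auto simp: Int_Diff_Un fmeasurableD2 intro!: fmeasurableD2 fmeasurable_Int_fmeasurable fmeasurable_Diff)
    thus "measure M (level_union T (E j) K - D) = card K * (e - p)"
      using 1 2 by (simp add: algebra_simps)
  qed
  have near: "measure M F - \<delta> < measure M G" "measure M (G - F) < \<delta>"
    if "measure M (sym_diff F G) < \<delta>" "F \<in> fmeasurable M" "G \<in> fmeasurable M" for F G
  proof -
    have sd: "sym_diff F G \<in> fmeasurable M" using that by (intro fmeasurable.Un fmeasurable.Diff)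
    have "measure M F \<le> measure M (G \<union> sym_diff F G)"
      using that sd by (intro measure_mono_fmeasurable) auto
    also have "\<dots> \<le> measure M G + measure M (sym_diff F G)"
      using that sd by (intro measure_Un_le) auto
    finally show "measure M F - \<delta> < measure M G" using that by simp
    have "measure M (G - F) \<le> measure M (sym_diff F G)"
      using that sd by (intro measure_mono_fmeasurable) auto
    thus "measure M (G - F) < \<delta>" using that by simp
  qed
  let ?I = "level_union T (E j) I" and ?J = "level_union T (E j) J"
  have f: "?I \<in> fmeasurable M" "?J \<in> fmeasurable M"
    using level_union_fmeasurable[OF T E] I(1) J(1) finite_subset by blast+
  have e0: "e \<ge> 0" by (simp add: e_def)
  have "measure M (?I - D) \<le> measure M (?I - A)"
    using f A D by (intro measure_mono_fmeasurable fmeasurable.Diff) auto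
  hence a: "card I * (e - p) < \<delta>" "3 * \<delta> < card I * e"
    using near[OF I(2) A(1) f(1)] lU[OF I(1)] \<delta> by auto
  have "measure M (?J \<inter> D) \<le> measure M (?J - B)"
    using f B D by (intro measure_mono_fmeasurable fmeasurable.Diff) auto
  hence b: "card J * p < \<delta>" "3 * \<delta> < card J * e"
    using near[OF J(2) B(1) f(2)] lU[OF J(1)] \<delta> by auto
  have "card I * (3 * (e - p)) < card I * e" using a by (simp add: algebra_simps)
  hence "3 * (e - p) < e" by (rule mult_left_less_imp_less) simp
  moreover have "card J * (3 * p) < card J * e" using b by (simp add: algebra_simps)
  hence "3 * p < e" by (rule mult_left_less_imp_less) simp
  ultimately show False using e0 by simp
qed

section \<open>Comparing the graph of \<open>S\<close> with the graphs of the powers of \<open>T\<close>\<close>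

text \<open>Moving \<open>S\<close> past \<open>T^a\<close> and cancelling the measure-preserving \<open>T^a\<close> leaves only the difference
  of the two heights. The commutation holds only almost everywhere, so the two sets are compared
  after pulling back to \<open>E\<close>.\<close>

lemma level_shift_measure:
  assumes T: "automorphism M T" and S: "automorphism M S"
    and c: "AE x in M. S (T x) = T (S x)" and E: "E \<in> sets M"
  shows "measure M (S ` (T ^^ a) ` E \<inter> (T ^^ b) ` E) =
    measure M (S ` E \<inter> autom_power M T (int b - int a) ` E)"
proof -
  let ?B = "(T ^^ b) ` E"
  note Esp = sets.sets_into_space[OF E]
  have B: "?B \<in> sets M" by (rule level_sets[OF T E])
  have mT: "T ^^ a \<in> measurable M M"
    using autom_power_measurable[OF T, of "int a"] by (simp add: autom_power_of_nat)
  note mS = automorphism_measurable[OF S]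
  have SE: "S ` E \<in> sets M" by (rule automorphism_image_sets[OF S E])
  let ?U = "{x \<in> space M. S ((T ^^ a) x) \<in> ?B}" and ?V = "{x \<in> space M. (T ^^ a) (S x) \<in> ?B}"
  have U: "?U \<in> sets M" and V: "?V \<in> sets M"
    using mT mS B by measurable
  have "S ` (T ^^ a) ` E \<inter> ?B = S ` (T ^^ a) ` (E \<inter> ?U)" using Esp by auto
  hence "measure M (S ` (T ^^ a) ` E \<inter> ?B) = measure M (E \<inter> ?U)"
    using E U by (simp add: automorphism_measure_image[OF S] level_measure[OF T] level_sets[OF T])
  also have "\<dots> = measure M (E \<inter> ?V)"
  proof (rule measure_eq_AE)
    show "AE x in M. x \<in> E \<inter> ?U \<longleftrightarrow> x \<in> E \<inter> ?V"
      using commute_funpow_AE[OF T c, of a] by eventually_elim simp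
  qed (use E U V in auto)
  also have "\<dots> = measure M ((T ^^ a) ` S ` (E \<inter> ?V))"
    using E V by (simp add: automorphism_measure_image[OF S] level_measure[OF T] automorphism_image_sets[OF S])
  also have "(T ^^ a) ` S ` (E \<inter> ?V) = (T ^^ a) ` S ` E \<inter> ?B" using Esp by auto
  also have "\<dots> = (T ^^ a) ` (S ` E \<inter> autom_power M T (int b - int a) ` E)"
  proof -
    have "?B = (T ^^ a) ` autom_power M T (int b - int a) ` E"
      using autom_power_image_add[OF T Esp, of "int a" "int b - int a"]
      by (simp add: autom_power_of_nat)
    moreover
    have "inj_on (T ^^ a) (space M)"
      using autom_power_inj[OF T, of "int a"] by (simp add: autom_power_of_nat)
    hence "(T ^^ a) ` (S ` E \<inter> autom_power M T (int b - int a) ` E) =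
        (T ^^ a) ` S ` E \<inter> (T ^^ a) ` autom_power M T (int b - int a) ` E"
      using sets.sets_into_space[OF SE] sets.sets_into_space[OF autom_power_image_sets[OF T E]]
      by (intro inj_on_image_Int)
    ultimately show ?thesis by metis
  qed
  also have "measure M \<dots> = measure M (S ` E \<inter> autom_power M T (int b - int a) ` E)"
    using SE autom_power_image_sets[OF T E] by (intro level_measure[OF T] sets.Int)
  finally show ?thesis .
qed

text \<open>Each half of the range of \<open>k\<close> is a translate of \<open>0..h\<close>, where the images of \<open>E\<close> are the
  disjoint levels of the tower; each half contributes at most the measure of \<open>S E\<close>.\<close>

lemma sum_correlations_le:
  assumes T: "automorphism M T" and S: "automorphism M S" and E: "E \<in> fmeasurable M"
    and dis: "disjoint_family_on (\<lambda>i. (T ^^ i) ` E) {..h}"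
  shows "(\<Sum>k\<in>{- int h..int h}. measure M (S ` E \<inter> autom_power M T k ` E)) \<le> 2 * measure M E"
proof -
  let ?P = "autom_power M T"
  have Es: "E \<in> sets M" using E by auto
  note Esp = sets.sets_into_space[OF Es]
  have SE: "S ` E \<in> fmeasurable M" by (rule automorphism_fmeasurable_image[OF S E])
  have one: "(\<Sum>k\<in>{m..m + int h}. measure M (S ` E \<inter> ?P k ` E)) \<le> measure M E" for m
  proof -
    have P: "?P k ` E \<in> sets M" for k by (rule autom_power_image_sets[OF T Es])
    have f: "S ` E \<inter> ?P k ` E \<in> fmeasurable M" for k
      using SE P by (rule fmeasurable_Int_fmeasurable)
    have "?P k ` E \<inter> ?P l ` E = {}"
      if kl: "k \<in> {m..m + int h}" "l \<in> {m..m + int h}" "k \<noteq> l" for k l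
    proof -
      have nn: "?P (i - m) ` E = (T ^^ nat (i - m)) ` E" if "i \<ge> m" for i
        using that by (simp add: autom_power_def)
      have "(T ^^ nat (k - m)) ` E \<inter> (T ^^ nat (l - m)) ` E = {}"
        using kl by (intro disjoint_family_onD[OF dis]) auto
      hence e: "?P (k - m) ` E \<inter> ?P (l - m) ` E = {}" using nn kl by auto
      have sp: "?P i ` E \<subseteq> space M" for i using sets.sets_into_space[OF P] .
      have "?P k ` E \<inter> ?P l ` E = ?P m ` ?P (k - m) ` E \<inter> ?P m ` ?P (l - m) ` E"
        using autom_power_image_add[OF T Esp, of m "k - m"] autom_power_image_add[OF T Esp, of m "l - m"]
        by simp
      also have "\<dots> = ?P m ` (?P (k - m) ` E \<inter> ?P (l - m) ` E)"
        using sp by (intro inj_on_image_Int[OF autom_power_inj[OF T], symmetric])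
      finally show ?thesis using e by simp
    qed
    hence "disjoint_family_on (\<lambda>k. S ` E \<inter> ?P k ` E) {m..m + int h}"
      unfolding disjoint_family_on_def by blast
    hence "(\<Sum>k\<in>{m..m + int h}. measure M (S ` E \<inter> ?P k ` E)) =
        measure M (\<Union>k\<in>{m..m + int h}. S ` E \<inter> ?P k ` E)"
      using f by (intro measure_finite_Union[symmetric]) (auto simp: fmeasurableD2)
    also have "\<dots> \<le> measure M (S ` E)"
      using f SE by (intro measure_mono_fmeasurable sets.finite_UN) auto
    also have "\<dots> = measure M E" by (rule automorphism_measure_image[OF S Es])
    finally show ?thesis .
  qed
  have "(\<Sum>k\<in>{- int h..int h}. measure M (S ` E \<inter> ?P k ` E)) \<le>
     (\<Sum>k\<in>{- int h..- int h + int h}. measure M (S ` E \<inter> ?P k ` E)) +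
     (\<Sum>k\<in>{0..0 + int h}. measure M (S ` E \<inter> ?P k ` E))"
  proof -
    have "{- int h..int h} = {- int h..- int h + int h} \<union> {0..0 + int h}" by auto
    thus ?thesis by (simp add: sum_Un sum_nonneg)
  qed
  with one[of "- int h"] one[of 0] show ?thesis by linarith
qed

text \<open>The set \<open>R i k\<close> in the proof collects the pairs of levels in the \<open>i\<close>-th rectangle whose heights
  differ by \<open>k\<close>. Each pair contributes \<open>w k\<close> to the graph of \<open>S\<close> and a full level, of
  measure \<open>e\<close>, to the graph of the \<open>k\<close>-th power of \<open>T\<close>. The assumed bound therefore limits the
  number of pairs, and the total weight bound turns this into the estimate for \<open>S\<close>.\<close>

lemma tower_domination:
  assumes T: "automorphism M T" and S: "automorphism M S"
    and c: "AE x in M. S (T x) = T (S x)" and E: "E \<in> fmeasurable M"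
    and dis: "disjoint_family_on (\<lambda>i. (T ^^ i) ` E) {..h}"
    and fin: "finite I" and UV: "\<And>i. i \<in> I \<Longrightarrow> U i \<subseteq> {..h}" "\<And>i. i \<in> I \<Longrightarrow> V i \<subseteq> {..h}"
    and bound: "\<And>k. (\<Sum>i\<in>I. measure M (autom_power M T k ` level_union T E (U i) \<inter>
        level_union T E (V i))) \<le> \<eta>"
  shows "(\<Sum>i\<in>I. measure M (S ` level_union T E (U i) \<inter> level_union T E (V i))) \<le> 2 * \<eta>"
proof -
  let ?P = "autom_power M T"
  let ?W = "level_union T E"
  have Es: "E \<in> sets M" using E by auto
  note Esp = sets.sets_into_space[OF Es]
  define e where "e = measure M E"
  define w where "w k = measure M (S ` E \<inter> ?P k ` E)" for k
  define R where "R i k = {ab \<in> U i \<times> V i. int (snd ab) - int (fst ab) = k}" for i k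
  define K where "K = {- int h..int h}"
  have finUV: "finite (U i)" "finite (V i)" if "i \<in> I" for i
    using finite_subset[OF UV(1)[OF that]] finite_subset[OF UV(2)[OF that]] by simp_all
  have w0: "w k \<ge> 0" for k by (simp add: w_def)
  have upper: "measure M (S ` ?W (U i) \<inter> ?W (V i)) \<le> (\<Sum>k\<in>K. card (R i k) * w k)"
    if i: "i \<in> I" for i
  proof -
    have "(\<Union>a\<in>U i. f a) \<inter> (\<Union>b\<in>V i. g b) = (\<Union>ab\<in>U i \<times> V i. f (fst ab) \<inter> g (snd ab))"
      for f g :: "nat \<Rightarrow> 'a set"
      by auto
    hence "S ` ?W (U i) \<inter> ?W (V i) =
        (\<Union>ab\<in>U i \<times> V i. S ` (T ^^ fst ab) ` E \<inter> (T ^^ snd ab) ` E)"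
      unfolding level_union_def image_UN .
    also have "measure M \<dots> \<le>
        (\<Sum>ab\<in>U i \<times> V i. measure M (S ` (T ^^ fst ab) ` E \<inter> (T ^^ snd ab) ` E))"
      using finUV[OF i]
      by (intro measure_UNION_le sets.Int automorphism_image_sets[OF S] level_sets[OF T Es]) auto
    also have "\<dots> = (\<Sum>ab\<in>U i \<times> V i. w (int (snd ab) - int (fst ab)))"
      by (simp add: level_shift_measure[OF T S c Es] w_def)
    also have "\<dots> = (\<Sum>k\<in>K. \<Sum>ab\<in>R i k. w (int (snd ab) - int (fst ab)))"
      unfolding R_def using finUV[OF i] UV[OF i]
      by (intro sum.group[symmetric]) (force simp: K_def)+
    also have "\<dots> = (\<Sum>k\<in>K. card (R i k) * w k)"
      by (intro sum.cong refl) (simp add: R_def)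
    finally show ?thesis .
  qed
  have lower: "card (R i k) * e \<le> measure M (?P k ` ?W (U i) \<inter> ?W (V i))" if i: "i \<in> I" for i k
  proof -
    have finR: "finite (R i k)" using finUV[OF i] by (simp add: R_def)
    have dR: "disjoint_family_on (\<lambda>ab. (T ^^ snd ab) ` E) (R i k)"
      unfolding disjoint_family_on_def
    proof (intro ballI impI)
      fix p q assume pq: "p \<in> R i k" "q \<in> R i k" "p \<noteq> q"
      hence "snd p \<noteq> snd q" by (auto simp: R_def prod_eq_iff)
      moreover have "snd p \<in> {..h}" "snd q \<in> {..h}" using pq UV[OF i] by (auto simp: R_def)
      ultimately show "(T ^^ snd p) ` E \<inter> (T ^^ snd q) ` E = {}"
        by (intro disjoint_family_onD[OF dis]) auto
    qed
    have "card (R i k) * e = measure M (\<Union>ab\<in>R i k. (T ^^ snd ab) ` E)"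
      using finR dR level_fmeasurable[OF T E]
      by (subst measure_finite_Union) (auto simp: level_measure[OF T Es] e_def dest: fmeasurableD2)
    also have "\<dots> \<le> measure M (?P k ` ?W (U i) \<inter> ?W (V i))"
    proof (rule measure_mono_fmeasurable)
      have f: "?W (U i) \<in> fmeasurable M" "?W (V i) \<in> fmeasurable M"
        using level_union_fmeasurable[OF T E] finUV[OF i] by auto
      show "?P k ` ?W (U i) \<inter> ?W (V i) \<in> fmeasurable M"
        using autom_power_fmeasurable_image[OF T f(1)] f(2) by (intro fmeasurable.Int)
      show "(\<Union>ab\<in>R i k. (T ^^ snd ab) ` E) \<in> sets M"
        using finR level_sets[OF T Es] by (intro sets.finite_UN) auto
      show "(\<Union>ab\<in>R i k. (T ^^ snd ab) ` E) \<subseteq> ?P k ` ?W (U i) \<inter> ?W (V i)"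
      proof (intro UN_least Int_greatest)
        fix ab assume ab: "ab \<in> R i k"
        have "(T ^^ snd ab) ` E = ?P k ` (T ^^ fst ab) ` E"
        proof -
          have "k + int (fst ab) = int (snd ab)" using ab by (auto simp: R_def)
          thus ?thesis
            using autom_power_image_add[OF T Esp, of k "int (fst ab)"]
            by (simp add: autom_power_of_nat)
        qed
        thus "(T ^^ snd ab) ` E \<subseteq> ?P k ` ?W (U i)"
          using ab unfolding level_union_def R_def image_UN by fastforce
        show "(T ^^ snd ab) ` E \<subseteq> ?W (V i)"
          using ab by (auto simp: level_union_def R_def)
      qed
    qed
    finally show ?thesis .
  qed
  have count: "(\<Sum>i\<in>I. real (card (R i k))) * e \<le> \<eta>" for k
    unfolding sum_distrib_right using sum_mono[OF lower] bound[of k] by (rule order_trans)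
  have sumw: "(\<Sum>k\<in>K. w k) \<le> 2 * e"
    unfolding w_def e_def K_def by (rule sum_correlations_le[OF T S E dis])
  have \<eta>: "\<eta> \<ge> 0" using bound[of 0] by (rule order_trans[rotated]) (simp add: sum_nonneg)
  have "(\<Sum>i\<in>I. measure M (S ` ?W (U i) \<inter> ?W (V i))) \<le> (\<Sum>i\<in>I. \<Sum>k\<in>K. card (R i k) * w k)"
    by (intro sum_mono upper)
  also have "\<dots> = (\<Sum>k\<in>K. (\<Sum>i\<in>I. real (card (R i k))) * w k)"
    by (subst sum.swap) (simp add: sum_distrib_right)
  also have "\<dots> \<le> 2 * \<eta>"
  proof (cases "e = 0")
    case True
    have "w k = 0" if "k \<in> K" for k
      using member_le_sum[of k K w] that w0 sumw True by (force simp: K_def intro: antisym)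
    thus ?thesis using \<eta> by simp
  next
    case False
    hence e: "e > 0" by (simp add: e_def less_le)
    have "(\<Sum>k\<in>K. (\<Sum>i\<in>I. real (card (R i k))) * w k) \<le> (\<Sum>k\<in>K. \<eta> / e * w k)"
      using count e w0 by (intro sum_mono mult_right_mono) (auto simp: pos_le_divide_eq)
    also have "\<dots> = \<eta> / e * (\<Sum>k\<in>K. w k)" by (simp add: sum_distrib_left)
    also have "\<dots> \<le> \<eta> / e * (2 * e)" using sumw \<eta> e by (intro mult_left_mono) auto
    finally show ?thesis using e by simp
  qed
  finally show ?thesis .
qed

lemma measure_image_Int_perturb:
  assumes A: "A \<in> fmeasurable M" "A' \<in> fmeasurable M" and B: "B \<in> fmeasurable M" "B' \<in> fmeasurable M"
    and F: "\<And>A. A \<in> fmeasurable M \<Longrightarrow> F ` A \<in> fmeasurable M"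
      "\<And>A. A \<in> fmeasurable M \<Longrightarrow> measure M (F ` A) = measure M A"
    and d: "measure M (sym_diff A A') < \<delta>" "measure M (sym_diff B B') < \<delta>"
  shows "measure M (F ` A \<inter> B) \<le> measure M (F ` A' \<inter> B') + 2 * \<delta>"
proof -
  have sd: "sym_diff A A' \<in> fmeasurable M" "sym_diff B B' \<in> fmeasurable M"
    using A B by (auto intro!: fmeasurable.Un fmeasurable.Diff)
  let ?D = "F ` sym_diff A A'"
  have f: "?D \<in> fmeasurable M" "F ` A \<inter> B \<in> fmeasurable M" "F ` A' \<inter> B' \<in> fmeasurable M"
    using F(1) A B sd by (auto intro!: fmeasurable.Int)
  have "measure M (F ` A \<inter> B) \<le> measure M ((F ` A' \<inter> B') \<union> (?D \<union> sym_diff B B'))"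
    using f sd by (intro measure_mono_fmeasurable fmeasurable.Un[OF _ fmeasurable.Un]) auto
  also have "\<dots> \<le> measure M (F ` A' \<inter> B') + measure M (?D \<union> sym_diff B B')"
    using f sd by (intro measure_Un_le) auto
  also have "measure M (?D \<union> sym_diff B B') \<le> measure M ?D + measure M (sym_diff B B')"
    using f sd by (intro measure_Un_le) auto
  also have "measure M ?D = measure M (sym_diff A A')" using sd F(2) by blast
  finally show ?thesis using d by linarith
qed

text \<open>The perturbation error of \<open>measure_image_Int_perturb\<close> is uniform in \<open>k\<close>, so passing to unions
  of levels spoils the hypothesis for all powers of \<open>T\<close> simultaneously by a small amount only.\<close>

lemma commuting_domination:
  assumes sf: "sigma_finite_measure M" and inf: "emeasure M (space M) = \<infinity>"
    and T: "automorphism M T" and r: "rank_one M T" and S: "automorphism M S"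
    and c: "AE x in M. S (T x) = T (S x)"
    and fin: "finite I" and A: "\<And>i. i \<in> I \<Longrightarrow> A i \<in> fmeasurable M"
    and B: "\<And>i. i \<in> I \<Longrightarrow> B i \<in> fmeasurable M"
    and bound: "\<And>k. (\<Sum>i\<in>I. measure M (autom_power M T k ` A i \<inter> B i)) \<le> \<epsilon>"
  shows "(\<Sum>i\<in>I. measure M (S ` A i \<inter> B i)) \<le> 2 * \<epsilon>"
proof (rule field_le_epsilon)
  fix \<rho> :: real assume \<rho>: "\<rho> > 0"
  \<comment> \<open>Each index costs \<open>2 \<delta>\<close> in the hypothesis, doubled by the domination, and \<open>2 \<delta>\<close> in the
    conclusion; the summand 1 covers an empty index set.\<close>
  define \<delta> where "\<delta> = \<rho> / (6 * (card I + 1))"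
  have \<delta>: "\<delta> > 0" and \<delta>\<rho>: "6 * (card I * \<delta>) \<le> \<rho>"
    using \<rho> by (auto simp: \<delta>_def field_simps)
  obtain E h where dis: "\<And>j. disjoint_family_on (\<lambda>i. (T ^^ i) ` E j) {..h j :: nat}"
    and app: "\<And>A \<delta>. A \<in> fmeasurable M \<Longrightarrow> \<delta> > 0 \<Longrightarrow>
      \<forall>\<^sub>F j in sequentially. E j \<in> fmeasurable M \<and>
        (\<exists>I\<subseteq>{..h j}. measure M (sym_diff A (level_union T (E j) I)) < \<delta>)"
    using rank_one_level_approx[OF sf inf T r] by blast
  have "\<forall>\<^sub>F j in sequentially. E j \<in> fmeasurable M \<and>
      (\<forall>i\<in>I. (\<exists>U\<subseteq>{..h j}. measure M (sym_diff (A i) (level_union T (E j) U)) < \<delta>) \<and>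
             (\<exists>U\<subseteq>{..h j}. measure M (sym_diff (B i) (level_union T (E j) U)) < \<delta>))"
  proof (intro eventually_conj eventually_ball_finite[OF fin] ballI)
    show "\<forall>\<^sub>F j in sequentially. E j \<in> fmeasurable M"
      using app[OF fmeasurable.empty_sets \<delta>] by (rule eventually_mono) blast
    fix i assume i: "i \<in> I"
    show "\<forall>\<^sub>F j in sequentially. \<exists>U\<subseteq>{..h j}. measure M (sym_diff (A i) (level_union T (E j) U)) < \<delta>"
      using app[OF A[OF i] \<delta>] by (rule eventually_mono) blast
    show "\<forall>\<^sub>F j in sequentially. \<exists>U\<subseteq>{..h j}. measure M (sym_diff (B i) (level_union T (E j) U)) < \<delta>"
      using app[OF B[OF i] \<delta>] by (rule eventually_mono) blast
  qed
  then obtain j where E: "E j \<in> fmeasurable M"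
    and "\<forall>i\<in>I. (\<exists>U\<subseteq>{..h j}. measure M (sym_diff (A i) (level_union T (E j) U)) < \<delta>) \<and>
             (\<exists>U\<subseteq>{..h j}. measure M (sym_diff (B i) (level_union T (E j) U)) < \<delta>)"
    using eventually_happens by force
  then obtain U V where
      U: "\<And>i. i \<in> I \<Longrightarrow> U i \<subseteq> {..h j}" "\<And>i. i \<in> I \<Longrightarrow> measure M (sym_diff (A i) (level_union T (E j) (U i))) < \<delta>"
    and V: "\<And>i. i \<in> I \<Longrightarrow> V i \<subseteq> {..h j}" "\<And>i. i \<in> I \<Longrightarrow> measure M (sym_diff (B i) (level_union T (E j) (V i))) < \<delta>"
    by metis
  let ?W = "level_union T (E j)"
  have W: "?W (U i) \<in> fmeasurable M" "?W (V i) \<in> fmeasurable M" if "i \<in> I" for i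
    using that U(1) V(1) level_union_fmeasurable[OF T E] by (meson finite_atMost finite_subset)+
  have comm: "sym_diff X Y = sym_diff Y X" for X Y :: "'a set" by auto
  have "(\<Sum>i\<in>I. measure M (S ` ?W (U i) \<inter> ?W (V i))) \<le> 2 * (\<epsilon> + card I * (2 * \<delta>))"
  proof (rule tower_domination[OF T S c E dis fin U(1) V(1)])
    fix k
    have "(\<Sum>i\<in>I. measure M (autom_power M T k ` ?W (U i) \<inter> ?W (V i))) \<le>
        (\<Sum>i\<in>I. measure M (autom_power M T k ` A i \<inter> B i) + 2 * \<delta>)"
      using A B W U(2) V(2) unfolding comm[of "A _"] comm[of "B _"]
      by (intro sum_mono measure_image_Int_perturb autom_power_fmeasurable_image[OF T]
          autom_power_measure_image[OF T]) auto
    also have "\<dots> \<le> \<epsilon> + card I * (2 * \<delta>)"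
      using bound[of k] by (simp add: sum.distrib)
    finally show "(\<Sum>i\<in>I. measure M (autom_power M T k ` ?W (U i) \<inter> ?W (V i))) \<le>
        \<epsilon> + card I * (2 * \<delta>)" .
  qed
  moreover have "(\<Sum>i\<in>I. measure M (S ` A i \<inter> B i)) \<le>
      (\<Sum>i\<in>I. measure M (S ` ?W (U i) \<inter> ?W (V i)) + 2 * \<delta>)"
    using A B W U(2) V(2)
    by (intro sum_mono measure_image_Int_perturb automorphism_fmeasurable_image[OF S]
        automorphism_measure_image[OF S]) auto
  ultimately show "(\<Sum>i\<in>I. measure M (S ` A i \<inter> B i)) \<le> 2 * \<epsilon> + \<rho>"
    using \<delta>\<rho> by (simp add: sum.distrib algebra_simps)
qed

section \<open>The centralizer\<close>

text \<open>Pulling back the rational half-lines under the isomorphism with the line separates points.\<close>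

lemma lebesgue_space_separating:
  assumes "lebesgue_space M"
  shows "\<exists>(F :: nat \<Rightarrow> 'a set) X. X \<in> sets M \<and> space M - X \<in> null_sets M \<and> range F \<subseteq> sets M \<and>
    (\<forall>x\<in>X. \<forall>y\<in>X. (\<forall>m. x \<in> F m \<longleftrightarrow> y \<in> F m) \<longrightarrow> x = y)"
proof -
  obtain N :: "real measure" and f X Y where N: "sets N = sets borel"
    and X: "X \<in> sets M" "space M - X \<in> null_sets M" and b: "bij_betw f X Y"
    and f: "f \<in> measurable (restrict_space M X) (restrict_space (completion N) Y)"
    and Y: "Y \<in> sets (completion N)"
    using assms unfolding lebesgue_space_def isomorphic_mod0_def by blast
  define q where "q m = real_of_rat (from_nat m)" for m
  define F where "F m = {x \<in> X. f x < q m}" for m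
  have Xs: "X \<subseteq> space M" using X(1) by (rule sets.sets_into_space)
  have FM: "F m \<in> sets M" for m
  proof -
    have "{..<q m} \<in> sets (completion N)" by (simp add: N)
    hence "Y \<inter> {..<q m} \<in> sets (restrict_space (completion N) Y)"
      by (auto simp: sets_restrict_space)
    from measurable_sets[OF f this]
    have "f -` (Y \<inter> {..<q m}) \<inter> X \<in> sets (restrict_space M X)"
      using Xs by (simp add: space_restrict_space Int_absorb2)
    moreover have "f -` (Y \<inter> {..<q m}) \<inter> X = F m"
      using b by (auto simp: F_def bij_betw_def)
    ultimately show ?thesis using X(1) by (simp add: sets_restrict_space_iff)
  qed
  have sep: "x = y" if xy: "x \<in> X" "y \<in> X" "\<And>m. x \<in> F m \<longleftrightarrow> y \<in> F m" for x y
  proof -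
    have no: "\<not> f x < f y" if xy: "x \<in> X" "y \<in> X" "\<And>m. x \<in> F m \<longleftrightarrow> y \<in> F m" for x y
    proof
      assume "f x < f y"
      then obtain r where r: "f x < real_of_rat r" "real_of_rat r < f y"
        using of_rat_dense by blast
      have "r = from_nat (to_nat r)" by simp
      with r xy(3)[of "to_nat r"] xy(1,2) show False by (auto simp: F_def q_def)
    qed
    have "f x = f y" using no[OF xy] no[of y x] xy by force
    thus ?thesis using b xy by (auto simp: bij_betw_def dest: inj_onD)
  qed
  show ?thesis
    using X FM sep by (intro exI[of _ F] exI[of _ X]) auto
qed

theorem mainTheorem2:
  fixes M :: "'a measure" and T S :: "'a \<Rightarrow> 'a"
  assumes "lebesgue_space M"
    and "sigma_finite_measure M"
    and "emeasure M (space M) = \<infinity>"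
    and "automorphism M T"
    and "mixing M T"
    and "rank_one M T"
    and "automorphism M S"
    and "AE x in M. S (T x) = T (S x)"
  shows "\<exists>i::int. AE x in M. S x = autom_power M T i x"
proof (rule ccontr)
  assume no: "\<not> ?thesis"
  note sf = assms(2) and inf = assms(3) and T = assms(4) and r = assms(6) and S = assms(7) and c = assms(8)
  let ?P = "autom_power M T"
  obtain F :: "nat \<Rightarrow> 'a set" and X where X: "X \<in> sets M" "space M - X \<in> null_sets M"
    and range_F: "range F \<subseteq> sets M"
    and sep': "\<forall>x\<in>X. \<forall>y\<in>X. (\<forall>m. x \<in> F m \<longleftrightarrow> y \<in> F m) \<longrightarrow> x = y"
    using lebesgue_space_separating[OF assms(1)] by (elim exE conjE)
  have F: "F m \<in> sets M" for m using range_F by blast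
  have sep: "x = y" if "x \<in> X" "y \<in> X" "\<And>m. x \<in> F m \<longleftrightarrow> y \<in> F m" for x y
    using sep' that by blast
  note [measurable] = F automorphism_measurable[OF S] automorphism_measurable[OF T]
    autom_power_measurable[OF T]
  \<comment> \<open>Modulo null sets this is the set where \<open>S = P k\<close>; in this form it is measurable.\<close>
  define D where "D k = {x \<in> space M. \<forall>m. S x \<in> F m \<longleftrightarrow> ?P k x \<in> F m}" for k
  have D: "D k \<in> sets M" for k unfolding D_def by measurable
  have AX: "AE x in M. x \<in> X"
    using AE_not_in[OF X(2)] AE_space by eventually_elim auto
  have autP: "AE x in M. ?P k x \<in> X" for k
  proof -
    have "space M \<inter> ?P k -` X = space M - ?P (- k) ` (space M - X)"
      using autom_power_image_eq[OF T, of "space M - X" "- k"] autom_power_in_space[OF T] by auto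
    moreover have "?P (- k) ` (space M - X) \<in> null_sets M"
      using X autom_power_emeasure_image[OF T, of "space M - X"] autom_power_image_sets[OF T, of "space M - X"]
      by (auto simp: null_sets_def)
    from AE_not_in[OF this] show ?thesis
      using AE_space by eventually_elim (use calculation in blast)
  qed
  have D_eq: "AE x in M. x \<in> D k \<longleftrightarrow> S x = ?P k x" for k
    using automorphism_AE[OF S AX] autP[of k] AE_space
    by eventually_elim (auto simp: D_def intro: sep)
  have Dnull: "AE x in M. x \<notin> D k" for k
  proof -
    have "AE x in M. x \<in> D k \<longleftrightarrow> T x \<in> D k"
      using D_eq[of k] automorphism_AE[OF T D_eq[of k]] c AE_space
    proof eventually_elim
      case (elim x)
      have PT: "?P k (T x) = T (?P k x)"
        using autom_power_add[OF T elim(4), of k 1] autom_power_succ[OF T elim(4), of k]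
          autom_power_of_nat[of M T 1] by simp
      have "S x = ?P k x \<longleftrightarrow> T (S x) = T (?P k x)"
        using automorphism_inj[OF T] automorphism_in_space[OF S elim(4)] autom_power_in_space[OF T elim(4)]
        by (auto dest: inj_onD)
      with elim PT show ?case by simp
    qed
    from rank_one_ergodic[OF sf inf T r D this]
    show ?thesis
    proof
      assume "AE x in M. x \<in> D k"
      with D_eq[of k] have "AE x in M. S x = ?P k x" by eventually_elim simp
      with no show ?thesis by blast
    qed
  qed
  obtain A where A: "A \<in> fmeasurable M" "measure M A > 0"
    using sigma_finite_pos_subset[OF sf sets.top] inf by auto
  have As: "A \<in> sets M" using A by auto
  note Asp = sets.sets_into_space[OF As]
  note [measurable] = As
  \<comment> \<open>Any constant above the domination constant 2 would do in place of 3.\<close>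
  define \<epsilon> where "\<epsilon> = measure M A / 3"
  have \<epsilon>: "\<epsilon> > 0" using A by (simp add: \<epsilon>_def)
  have SA: "S ` A \<in> fmeasurable M" by (rule automorphism_fmeasurable_image[OF S A(1)])
  obtain N :: nat where N: "\<And>k::int. \<bar>k\<bar> > int N \<Longrightarrow> measure M (?P k ` A \<inter> S ` A) < \<epsilon>"
    using assms(5) A(1) SA \<epsilon> unfolding mixing_def by meson
  \<comment> \<open>The points of \<open>A\<close> where the first \<open>n\<close> separating sets do not tell \<open>S\<close> from \<open>P k\<close>.\<close>
  define G where "G k n = {x \<in> A. \<forall>m<n. S x \<in> F m \<longleftrightarrow> ?P k x \<in> F m}" for k n
  have Gs: "G k n \<in> sets M" for k n
  proof -
    have "G k n = A \<inter> {x \<in> space M. \<forall>m<n. S x \<in> F m \<longleftrightarrow> ?P k x \<in> F m}"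
      using Asp by (auto simp: G_def)
    also have "\<dots> \<in> sets M" by measurable
    finally show ?thesis .
  qed
  have Gf: "G k n \<in> fmeasurable M" for k n
    by (rule fmeasurableI2[OF A(1) _ Gs]) (auto simp: G_def)
  have Glim: "(\<lambda>n. measure M (G k n)) \<longlonglongrightarrow> 0" for k
  proof -
    have "(\<lambda>n. measure M (G k n)) \<longlonglongrightarrow> measure M (\<Inter>n. G k n)"
      using Gs Gf by (intro Lim_measure_decseq) (auto simp: decseq_def G_def fmeasurableD2)
    also have "(\<Inter>n. G k n) = A \<inter> D k"
      using Asp by (auto simp: G_def D_def)
    also have "measure M (A \<inter> D k) = measure M {}"
      using Dnull[of k] As D by (intro measure_eq_AE) (auto elim!: eventually_mono)
    finally show ?thesis by simp
  qed
  have "\<forall>\<^sub>F n in sequentially. \<forall>k\<in>{- int N..int N}. measure M (G k n) < \<epsilon>"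
    using Glim \<epsilon> by (intro eventually_ball_finite ballI) (auto dest: order_tendstoD(2))
  then obtain n where n: "\<And>k. k \<in> {- int N..int N} \<Longrightarrow> measure M (G k n) < \<epsilon>"
    using eventually_happens by force
  \<comment> \<open>A cell is coded by the set \<open>s\<close> of indices of the separating sets that contain it; \<open>Q s\<close> is
    its preimage under \<open>S\<close> in \<open>A\<close>.\<close>
  define Q where "Q s = {x \<in> A. \<forall>m<n. S x \<in> F m \<longleftrightarrow> m \<in> s}" for s :: "nat set"
  let ?I = "Pow {..<n}"
  have Qs: "Q s \<in> sets M" for s
  proof -
    have "Q s = A \<inter> {x \<in> space M. \<forall>m<n. S x \<in> F m \<longleftrightarrow> m \<in> s}" using Asp by (auto simp: Q_def)
    also have "\<dots> \<in> sets M" by measurable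
    finally show ?thesis .
  qed
  have Qf: "Q s \<in> fmeasurable M" for s
    by (rule fmeasurableI2[OF A(1) _ Qs]) (auto simp: Q_def)
  have SQf: "S ` Q s \<in> fmeasurable M" for s by (rule automorphism_fmeasurable_image[OF S Qf])
  have QA: "(\<Union>s\<in>?I. Q s) = A"
  proof (intro equalityI subsetI)
    fix x assume x: "x \<in> A"
    hence "x \<in> Q {m. m < n \<and> S x \<in> F m}" by (auto simp: Q_def)
    thus "x \<in> (\<Union>s\<in>?I. Q s)" by (rule UN_I[rotated]) auto
  qed (auto simp: Q_def)
  have Qdis: "disjoint_family_on (\<lambda>s. S ` Q s) ?I"
    unfolding disjoint_family_on_def
  proof (intro ballI impI)
    fix s t assume st: "s \<in> ?I" "t \<in> ?I" "s \<noteq> t"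
    then obtain m where m: "m < n" "m \<in> s \<longleftrightarrow> m \<notin> t" by blast
    thus "S ` Q s \<inter> S ` Q t = {}" by (auto simp: Q_def)
  qed
  have bound: "(\<Sum>s\<in>?I. measure M (?P k ` Q s \<inter> S ` Q s)) \<le> \<epsilon>" for k
  proof -
    have f: "?P k ` Q s \<inter> S ` Q s \<in> fmeasurable M" for s
      using autom_power_fmeasurable_image[OF T Qf] SQf by (rule fmeasurable.Int)
    have "disjoint_family_on (\<lambda>s. ?P k ` Q s \<inter> S ` Q s) ?I"
      using Qdis unfolding disjoint_family_on_def by blast
    hence "(\<Sum>s\<in>?I. measure M (?P k ` Q s \<inter> S ` Q s)) = measure M (\<Union>s\<in>?I. ?P k ` Q s \<inter> S ` Q s)"
      using f by (intro measure_finite_Union[symmetric]) (auto simp: fmeasurableD2)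
    also have "\<dots> \<le> \<epsilon>"
    proof (cases "k \<in> {- int N..int N}")
      case True
      have "measure M (\<Union>s\<in>?I. ?P k ` Q s \<inter> S ` Q s) \<le> measure M (?P k ` G k n)"
      proof (rule measure_mono_fmeasurable)
        show "(\<Union>s\<in>?I. ?P k ` Q s \<inter> S ` Q s) \<subseteq> ?P k ` G k n"
        proof (intro UN_least subsetI)
          fix s y assume "y \<in> ?P k ` Q s \<inter> S ` Q s"
          then obtain x x' where x: "x \<in> Q s" "y = ?P k x" and x': "x' \<in> Q s" "y = S x'" by auto
          have "x \<in> G k n" using x x' by (auto simp: Q_def G_def)
          thus "y \<in> ?P k ` G k n" using x by simp
        qed
        show "(\<Union>s\<in>?I. ?P k ` Q s \<inter> S ` Q s) \<in> sets M"
          using f by (intro sets.finite_UN) auto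
        show "?P k ` G k n \<in> fmeasurable M" by (rule autom_power_fmeasurable_image[OF T Gf])
      qed
      also have "\<dots> = measure M (G k n)" by (rule autom_power_measure_image[OF T Gs])
      finally show ?thesis using n[OF True] by simp
    next
      case False
      hence k: "\<bar>k\<bar> > int N" by auto
      have "measure M (\<Union>s\<in>?I. ?P k ` Q s \<inter> S ` Q s) \<le> measure M (?P k ` A \<inter> S ` A)"
      proof (rule measure_mono_fmeasurable)
        show "(\<Union>s\<in>?I. ?P k ` Q s \<inter> S ` Q s) \<subseteq> ?P k ` A \<inter> S ` A" by (auto simp: Q_def)
        show "(\<Union>s\<in>?I. ?P k ` Q s \<inter> S ` Q s) \<in> sets M"
          using f by (intro sets.finite_UN) auto
        show "?P k ` A \<inter> S ` A \<in> fmeasurable M"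
          using autom_power_fmeasurable_image[OF T A(1)] SA by (rule fmeasurable.Int)
      qed
      with N[OF k] show ?thesis by simp
    qed
    finally show ?thesis .
  qed
  have "measure M A = measure M (S ` A)" by (rule automorphism_measure_image[OF S As, symmetric])
  also have "S ` A = (\<Union>s\<in>?I. S ` Q s)" using QA by blast
  also have "measure M \<dots> = (\<Sum>s\<in>?I. measure M (S ` Q s))"
    using SQf Qdis by (intro measure_finite_Union) (auto simp: fmeasurableD2)
  also have "\<dots> = (\<Sum>s\<in>?I. measure M (S ` Q s \<inter> S ` Q s))" by simp
  also have "\<dots> \<le> 2 * \<epsilon>"
    using commuting_domination[OF sf inf T r S c _ Qf SQf bound] by simp
  finally show False using \<epsilon> by (simp add: \<epsilon>_def)
qed

end
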